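(* Let $p\ge2$ and let $\{X_n\}_{n\in\mathbb Z}\subset L_H^2$ be a linear process in $H$, i.e. $X_n=\sum_{j=0}^\infty\Psi_j(\varepsilon_{n-j})$, where the errors $\varepsilon_n\in L_H^2$ are i.i.d. with mean zero and each $\Psi_j:H\to H$ is a bounded linear operator. Suppose that $\nu_p(\varepsilon_0)<\infty$ and that $$\sum_{m=1}^\infty\sum_{j=m}^\infty\|\Psi_j\|<\infty,$$ where $\|\cdot\|$ is the operator norm. Then $\{X_n\}$ is $L^p$--$m$-approximable.
   Context: $H=L^2([0,1],\mathcal B_{[0,1]},\lambda)$ with norm $\|f\|^2=\int_0^1|f(t)|^2dt$. $L_H^p$ is the space of $H$-valued random elements $X$ with $\nu_p(X)=(E\|X\|^p)^{1/p}<\infty$. $L^p$--$m$-approximability: a sequence $\{X_n\}_{n\in\mathbb Z}\subset L_H^p$ is $L^p$--$m$-approximable if $X_n=f(\varepsilon_n,\varepsilon_{n-1},\ldots)$ for all $n$, where $\{\varepsilon_i\}_{i\in\mathbb Z}$ are i.i.d. elements with values in a measurable space $S$ and $f:S^\infty\to H$ is measurable, and moreover $\sum_{m=1}^\infty\nu_p(X_m-X_m^{(m)})<\infty$, where $$X_n^{(m)}=f\bigl(\varepsilon_n,\ldots,\varepsilon_{n-m+1},\varepsilon_{n-m}^{(n)},\varepsilon_{n-m-1}^{(n)},\ldots\bigr)$$ and, for each $n$, $\{\varepsilon_k^{(n)}\}_{k}$ is an independent copy of $\{\varepsilon_k\}_k$ (these copies for different $n$ being independent of each other and of $\{\varepsilon_k\}$).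 *)

theory Defs
  imports "HOL-Probability.Probability"
begin

section \<open>The Hilbert space of square-integrable functions on the unit interval\<close>

definition unit_lborel :: "real measure" where
  "unit_lborel = restrict_space lborel {0..1}"

definition square_integrable :: "(real \<Rightarrow> real) \<Rightarrow> bool" where
  "square_integrable f \<longleftrightarrow>
     f \<in> borel_measurable unit_lborel \<and> integrable unit_lborel (\<lambda>t. (f t)\<^sup>2)"

lemma space_unit_lborel [simp]: "space unit_lborel = {0..1}"
  by (simp add: unit_lborel_def space_restrict_space)

lemma measurable_unit_lborel: "f \<in> borel_measurable borel \<Longrightarrow> f \<in> borel_measurable unit_lborel"
  unfolding unit_lborel_def by (intro measurable_restrict_space1) simp

lemma emeasure_unit_lborel: "A \<in> sets borel \<Longrightarrow> A \<subseteq> {0..1} \<Longrightarrow> emeasure unit_lborel A = emeasure lborel A"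
  unfolding unit_lborel_def by (subst emeasure_restrict_space) auto

lemma prob_space_unit_lborel: "prob_space unit_lborel"
  by (rule prob_spaceI) (simp add: emeasure_unit_lborel)

interpretation unit_lborel: prob_space unit_lborel
  by (rule prob_space_unit_lborel)

lemma square_integrable_measurable:
  "square_integrable f \<Longrightarrow> f \<in> borel_measurable unit_lborel"
  by (simp add: square_integrable_def)

lemma square_integrable_mult:
  assumes f: "square_integrable f" and g: "square_integrable g"
  shows "integrable unit_lborel (\<lambda>t. f t * g t)"
proof (rule Bochner_Integration.integrable_bound)
  show "integrable unit_lborel (\<lambda>t. (f t)\<^sup>2 + (g t)\<^sup>2)"
    using f g by (auto simp: square_integrable_def)
  show "(\<lambda>t. f t * g t) \<in> borel_measurable unit_lborel"
    using f g by (auto simp: square_integrable_def)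
  have "\<bar>a * b\<bar> \<le> a\<^sup>2 + b\<^sup>2" for a b :: real
  proof -
    have "2 * \<bar>a * b\<bar> \<le> a\<^sup>2 + b\<^sup>2"
      using zero_le_power2[of "\<bar>a\<bar> - \<bar>b\<bar>"] by (simp add: power2_diff abs_mult)
    then show ?thesis by linarith
  qed
  then show "AE t in unit_lborel. norm (f t * g t) \<le> norm ((f t)\<^sup>2 + (g t)\<^sup>2)"
    by simp
qed

lemma square_integrable_add:
  assumes f: "square_integrable f" and g: "square_integrable g"
  shows "square_integrable (\<lambda>t. f t + g t)"
proof -
  have "integrable unit_lborel (\<lambda>t. (f t)\<^sup>2 + (g t)\<^sup>2 + 2 * (f t * g t))"
    using f g square_integrable_mult[OF f g] by (auto simp: square_integrable_def)
  moreover have "(\<lambda>t. (f t)\<^sup>2 + (g t)\<^sup>2 + 2 * (f t * g t)) = (\<lambda>t. (f t + g t)\<^sup>2)"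
    by (auto simp: power2_sum algebra_simps)
  ultimately show ?thesis
    using f g by (auto simp: square_integrable_def)
qed

lemma square_integrable_scale: "square_integrable f \<Longrightarrow> square_integrable (\<lambda>t. c * f t)"
  by (auto simp: square_integrable_def power_mult_distrib)

lemma square_integrable_uminus: "square_integrable f \<Longrightarrow> square_integrable (\<lambda>t. - f t)"
  by (auto simp: square_integrable_def)

lemma square_integrable_diff:
  "square_integrable f \<Longrightarrow> square_integrable g \<Longrightarrow> square_integrable (\<lambda>t. f t - g t)"
  using square_integrable_add[of f "\<lambda>t. - g t"] square_integrable_uminus[of g] by simp

lemma square_integrable_bounded:
  assumes "f \<in> borel_measurable unit_lborel" "\<And>t. \<bar>f t\<bar> \<le> B"
  shows "square_integrable f"
  unfolding square_integrable_def
proof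
  show "integrable unit_lborel (\<lambda>t. (f t)\<^sup>2)"
  proof (rule unit_lborel.integrable_const_bound[where B = "B\<^sup>2"])
    show "AE t in unit_lborel. norm ((f t)\<^sup>2) \<le> B\<^sup>2"
      using assms(2) by (auto simp: abs_le_square_iff intro!: AE_I2)
        (metis abs_ge_zero assms(2) power2_abs power_mono)
  qed (use assms(1) in simp)
qed (rule assms(1))

lemma square_integrable_zero: "square_integrable (\<lambda>t. 0)"
  by (simp add: square_integrable_def)

text \<open>The elements of \<open>L2\<close> are the classes of square-integrable functions modulo equality almost
  everywhere on \<open>[0,1]\<close>; values outside \<open>[0,1]\<close> are irrelevant.\<close>

quotient_type L2 = "real \<Rightarrow> real" / partial:
  "\<lambda>f g. square_integrable f \<and> square_integrable g \<and> (AE t in unit_lborel. f t = g t)"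
proof (rule part_equivpI)
  show "\<exists>f. square_integrable f \<and> square_integrable f \<and> (AE t in unit_lborel. f t = f t)"
    using square_integrable_zero by auto
  show "symp (\<lambda>f g. square_integrable f \<and> square_integrable g \<and> (AE t in unit_lborel. f t = g t))"
    by (rule sympI) (auto elim: eventually_mono)
  show "transp (\<lambda>f g. square_integrable f \<and> square_integrable g \<and> (AE t in unit_lborel. f t = g t))"
    by (rule transpI) (auto elim: eventually_elim2)
qed

instantiation L2 :: real_inner
begin

lift_definition zero_L2 :: L2 is "\<lambda>t. 0"
  by (simp add: square_integrable_zero)

lift_definition plus_L2 :: "L2 \<Rightarrow> L2 \<Rightarrow> L2" is "\<lambda>f g t. f t + g t"
  by (auto intro: square_integrable_add elim: eventually_elim2)

lift_definition uminus_L2 :: "L2 \<Rightarrow> L2" is "\<lambda>f t. - f t"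
  by (auto intro: square_integrable_uminus elim: eventually_mono)

lift_definition minus_L2 :: "L2 \<Rightarrow> L2 \<Rightarrow> L2" is "\<lambda>f g t. f t - g t"
  by (auto intro: square_integrable_diff elim: eventually_elim2)

lift_definition scaleR_L2 :: "real \<Rightarrow> L2 \<Rightarrow> L2" is "\<lambda>c f t. c * f t"
  by (auto intro: square_integrable_scale elim: eventually_mono)

lift_definition inner_L2 :: "L2 \<Rightarrow> L2 \<Rightarrow> real" is "\<lambda>f g. \<integral>t. f t * g t \<partial>unit_lborel"
  by (rule integral_cong_AE)
    (auto dest!: square_integrable_measurable elim: eventually_elim2)

definition norm_L2 :: "L2 \<Rightarrow> real" where "norm_L2 x = sqrt (inner x x)"

definition dist_L2 :: "L2 \<Rightarrow> L2 \<Rightarrow> real" where "dist_L2 x y = norm (x - y)"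

definition sgn_L2 :: "L2 \<Rightarrow> L2" where "sgn_L2 x = inverse (norm x) *\<^sub>R x"

definition uniformity_L2 :: "(L2 \<times> L2) filter" where
  "uniformity_L2 = (INF e\<in>{0<..}. principal {(x, y). dist x y < e})"

definition open_L2 :: "L2 set \<Rightarrow> bool" where
  "open_L2 U \<longleftrightarrow> (\<forall>x\<in>U. \<forall>\<^sub>F (x', y) in uniformity. x' = x \<longrightarrow> y \<in> U)"

instance
proof
  fix x y z :: L2 and a b :: real
  show "x + y + z = x + (y + z)"
    by transfer (auto intro!: square_integrable_add simp: add.assoc)
  show "x + y = y + x"
    by transfer (auto intro!: square_integrable_add simp: add.commute)
  show "0 + x = x"
    by transfer auto
  show "- x + x = 0"
    by transfer (auto intro: square_integrable_zero)
  show "x - y = x + - y"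
    by transfer (auto intro!: square_integrable_diff)
  show "a *\<^sub>R (x + y) = a *\<^sub>R x + a *\<^sub>R y"
    by transfer (auto intro!: square_integrable_add square_integrable_scale simp: distrib_left)
  show "(a + b) *\<^sub>R x = a *\<^sub>R x + b *\<^sub>R x"
    by transfer (auto intro!: square_integrable_add square_integrable_scale simp: distrib_right)
  show "a *\<^sub>R b *\<^sub>R x = (a * b) *\<^sub>R x"
    by transfer (auto intro!: square_integrable_scale simp: mult.assoc)
  show "1 *\<^sub>R x = x"
    by transfer auto
  show "dist x y = norm (x - y)" by (rule dist_L2_def)
  show "sgn x = inverse (norm x) *\<^sub>R x" by (rule sgn_L2_def)
  show "(uniformity :: (L2 \<times> L2) filter) = (INF e\<in>{0<..}. principal {(x, y). dist x y < e})"
    by (rule uniformity_L2_def)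
  show "open U \<longleftrightarrow> (\<forall>x\<in>U. \<forall>\<^sub>F (x', y) in uniformity. x' = x \<longrightarrow> y \<in> U)" for U :: "L2 set"
    by (rule open_L2_def)
  show "inner x y = inner y x"
    by transfer (simp add: mult.commute)
  show "inner (x + y) z = inner x z + inner y z"
    by transfer (simp add: distrib_right square_integrable_mult)
  show "inner (a *\<^sub>R x) y = a * inner x y"
    by transfer (simp add: mult.assoc)
  show "0 \<le> inner x x"
    by transfer simp
  show "inner x x = 0 \<longleftrightarrow> x = 0"
  proof transfer
    fix f assume "square_integrable f \<and> square_integrable f \<and> (AE t in unit_lborel. f t = f t)"
    then have f: "square_integrable f" by simp
    have "(\<integral>t. f t * f t \<partial>unit_lborel) = 0 \<longleftrightarrow> (AE t in unit_lborel. f t * f t = 0)"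
      by (rule integral_nonneg_eq_0_iff_AE) (auto intro: square_integrable_mult f)
    then show "(\<integral>t. f t * f t \<partial>unit_lborel) = 0 \<longleftrightarrow>
        square_integrable f \<and> square_integrable (\<lambda>t. 0) \<and> (AE t in unit_lborel. f t = 0)"
      by (simp add: f square_integrable_zero)
  qed
  show "norm x = sqrt (inner x x)" by (rule norm_L2_def)
qed

end

lemma L2_cases [case_names abs]:
  obtains f where "x = abs_L2 f" "square_integrable f"
proof -
  have "square_integrable (rep_L2 x)" "abs_L2 (rep_L2 x) = x"
    using Quotient3_L2 by (auto simp: Quotient3_def)
  then show ?thesis using that by metis
qed

lemma abs_L2_eqI:
  assumes "square_integrable f" "square_integrable g" "\<And>t. t \<in> {0..1} \<Longrightarrow> f t = g t"
  shows "abs_L2 f = abs_L2 g"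
proof (rule Quotient3_rel_abs[OF Quotient3_L2])
  have "AE t in unit_lborel. f t = g t"
    by (rule AE_I2) (use assms(3) in simp)
  then show "square_integrable f \<and> square_integrable g \<and> (AE t in unit_lborel. f t = g t)"
    using assms by simp
qed

lemma norm_abs_L2: "square_integrable f \<Longrightarrow> (norm (abs_L2 f))\<^sup>2 = (\<integral>t. (f t)\<^sup>2 \<partial>unit_lborel)"
  by (simp only: power2_norm_eq_inner power2_eq_square[of "f _"]) (simp add: inner_L2.abs_eq)

lemma diff_abs_L2:
  "square_integrable f \<Longrightarrow> square_integrable g \<Longrightarrow> abs_L2 f - abs_L2 g = abs_L2 (\<lambda>t. f t - g t)"
  by (simp add: minus_L2.abs_eq)

lemma add_abs_L2:
  "square_integrable f \<Longrightarrow> square_integrable g \<Longrightarrow> abs_L2 f + abs_L2 g = abs_L2 (\<lambda>t. f t + g t)"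
  by (simp add: plus_L2.abs_eq)

lemma scaleR_abs_L2: "square_integrable f \<Longrightarrow> c *\<^sub>R abs_L2 f = abs_L2 (\<lambda>t. c * f t)"
  by (simp add: scaleR_L2.abs_eq)


subsection \<open>Completeness\<close>

lemma integral_abs_le_norm_L2:
  assumes f: "square_integrable f"
  shows "(\<integral>t. \<bar>f t\<bar> \<partial>unit_lborel) \<le> norm (abs_L2 f)"
proof -
  have f': "square_integrable (\<lambda>t. \<bar>f t\<bar>)"
    using f by (auto simp: square_integrable_def)
  have one: "square_integrable (\<lambda>t. 1)"
    by (rule square_integrable_bounded[where B = 1]) auto
  have "(norm (abs_L2 (\<lambda>t. 1)))\<^sup>2 = 1"
    using norm_abs_L2[OF one] unit_lborel.prob_space by simp
  then have n1: "norm (abs_L2 (\<lambda>t. 1)) = 1"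
    by (simp add: power2_eq_1_iff) (metis norm_ge_zero not_one_le_zero le_minus_one_simps(3))
  have n2: "norm (abs_L2 (\<lambda>t. \<bar>f t\<bar>)) = norm (abs_L2 f)"
    by (rule power2_eq_imp_eq) (simp_all add: norm_abs_L2 f f')
  have "(\<integral>t. \<bar>f t\<bar> \<partial>unit_lborel) = inner (abs_L2 (\<lambda>t. \<bar>f t\<bar>)) (abs_L2 (\<lambda>t. 1))"
    using f' one by (simp add: inner_L2.abs_eq)
  also have "\<dots> \<le> norm (abs_L2 (\<lambda>t. \<bar>f t\<bar>)) * norm (abs_L2 (\<lambda>t. 1))"
    by (rule norm_cauchy_schwarz)
  finally show ?thesis by (simp add: n1 n2)
qed

lemma square_integrable_abs_integrable:
  assumes f: "square_integrable f"
  shows "integrable unit_lborel (\<lambda>t. \<bar>f t\<bar>)"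
proof -
  have "square_integrable (\<lambda>t. \<bar>f t\<bar>)"
    using f by (auto simp: square_integrable_def)
  moreover have "square_integrable (\<lambda>t. 1)"
    by (rule square_integrable_bounded[where B = 1]) auto
  ultimately show ?thesis
    using square_integrable_mult by fastforce
qed

lemma L2_fast_Cauchy_converges:
  fixes Y :: "nat \<Rightarrow> L2"
  assumes Y: "\<And>k l. k \<le> l \<Longrightarrow> norm (Y k - Y l) \<le> (1/2) ^ k"
  shows "convergent Y"
proof -
  have "\<forall>k. \<exists>f. Y k = abs_L2 f \<and> square_integrable f"
    by (metis L2_cases)
  then obtain f where f: "\<And>k. Y k = abs_L2 (f k)" "\<And>k. square_integrable (f k)"
    by metis
  have [measurable]: "f k \<in> borel_measurable unit_lborel" for k
    using f(2) by (rule square_integrable_measurable)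
  define g where "g k t = f (Suc k) t - f k t" for k t
  have g: "square_integrable (g k)" for k
    unfolding g_def by (intro square_integrable_diff f)
  have [measurable]: "g k \<in> borel_measurable unit_lborel" for k
    using g by (rule square_integrable_measurable)
  have g_le: "(\<integral>t. \<bar>g k t\<bar> \<partial>unit_lborel) \<le> (1/2) ^ k" for k
  proof -
    have "(\<integral>t. \<bar>g k t\<bar> \<partial>unit_lborel) \<le> norm (abs_L2 (g k))"
      by (rule integral_abs_le_norm_L2[OF g])
    also have "abs_L2 (g k) = Y (Suc k) - Y k"
      unfolding g_def f(1) by (subst diff_abs_L2) (simp_all add: f)
    also have "norm (Y (Suc k) - Y k) \<le> (1/2) ^ k"
      using Y[of k "Suc k"] by (simp add: norm_minus_commute)
    finally show ?thesis .
  qed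
  have "(\<integral>\<^sup>+t. (\<Sum>k. ennreal \<bar>g k t\<bar>) \<partial>unit_lborel) = (\<Sum>k. \<integral>\<^sup>+t. ennreal \<bar>g k t\<bar> \<partial>unit_lborel)"
    by (rule nn_integral_suminf) simp
  also have "\<dots> = (\<Sum>k. ennreal (\<integral>t. \<bar>g k t\<bar> \<partial>unit_lborel))"
    by (intro suminf_cong nn_integral_eq_integral square_integrable_abs_integrable g) simp
  also have "\<dots> \<le> (\<Sum>k. ennreal ((1/2) ^ k))"
    by (intro suminf_le ennreal_leI g_le) auto
  also have "\<dots> = ennreal (1 / (1 - 1/2))"
    by (intro suminf_ennreal_eq geometric_sums) auto
  finally have "(\<integral>\<^sup>+t. (\<Sum>k. ennreal \<bar>g k t\<bar>) \<partial>unit_lborel) \<noteq> \<infinity>"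
    by (auto simp: top_unique)
  then have "AE t in unit_lborel. (\<Sum>k. ennreal \<bar>g k t\<bar>) \<noteq> \<infinity>"
    by (intro nn_integral_PInf_AE) auto
  then have conv: "AE t in unit_lborel. convergent (\<lambda>k. f k t)"
  proof eventually_elim
    case (elim t)
    have "summable (\<lambda>k. \<bar>g k t\<bar>)"
      by (rule summable_suminf_not_top) (use elim in auto)
    then have "summable (\<lambda>k. g k t)"
      by (rule summable_rabs_cancel)
    then have "convergent (\<lambda>n. \<Sum>k<n. g k t)"
      by (simp add: summable_iff_convergent)
    moreover have "(\<lambda>n. \<Sum>k<n. g k t) = (\<lambda>n. f n t - f 0 t)"
      unfolding g_def using sum_lessThan_telescope[of "\<lambda>k. f k t"] by auto
    ultimately show ?case
      using convergent_add[of "\<lambda>n. f n t - f 0 t" "\<lambda>n. f 0 t"] by (simp add: convergent_const)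
  qed
  define F where "F t = lim (\<lambda>k. f k t)" for t
  have [measurable]: "F \<in> borel_measurable unit_lborel"
    unfolding F_def by measurable
  have lim: "AE t in unit_lborel. (\<lambda>k. f k t) \<longlonglongrightarrow> F t"
    using conv by eventually_elim (simp add: F_def convergent_LIMSEQ_iff)
  have fatou: "(\<integral>\<^sup>+t. ennreal ((f k t - F t)\<^sup>2) \<partial>unit_lborel) \<le> ennreal (((1/2) ^ k)\<^sup>2)" for k
  proof -
    have "(\<integral>\<^sup>+t. ennreal ((f k t - F t)\<^sup>2) \<partial>unit_lborel)
        = (\<integral>\<^sup>+t. liminf (\<lambda>l. ennreal ((f k t - f l t)\<^sup>2)) \<partial>unit_lborel)"
    proof (rule nn_integral_cong_AE)
      show "AE t in unit_lborel. ennreal ((f k t - F t)\<^sup>2) = liminf (\<lambda>l. ennreal ((f k t - f l t)\<^sup>2))"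
        using lim
      proof eventually_elim
        case (elim t)
        have "(\<lambda>l. ennreal ((f k t - f l t)\<^sup>2)) \<longlonglongrightarrow> ennreal ((f k t - F t)\<^sup>2)"
          by (intro tendsto_intros elim)
        from lim_imp_Liminf[OF _ this] show ?case
          by simp
      qed
    qed
    also have "\<dots> \<le> liminf (\<lambda>l. \<integral>\<^sup>+t. ennreal ((f k t - f l t)\<^sup>2) \<partial>unit_lborel)"
      by (rule nn_integral_liminf) simp
    also have "\<dots> \<le> limsup (\<lambda>l. \<integral>\<^sup>+t. ennreal ((f k t - f l t)\<^sup>2) \<partial>unit_lborel)"
      by (rule Liminf_le_Limsup) simp
    also have "\<dots> \<le> ennreal (((1/2) ^ k)\<^sup>2)"
    proof (rule Limsup_bounded, rule eventually_sequentiallyI)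
      fix l assume "k \<le> l"
      have sq: "square_integrable (\<lambda>t. f k t - f l t)"
        by (intro square_integrable_diff f)
      have "(\<integral>\<^sup>+t. ennreal ((f k t - f l t)\<^sup>2) \<partial>unit_lborel)
          = ennreal (\<integral>t. (f k t - f l t)\<^sup>2 \<partial>unit_lborel)"
        using sq by (intro nn_integral_eq_integral) (auto simp: square_integrable_def)
      also have "(\<integral>t. (f k t - f l t)\<^sup>2 \<partial>unit_lborel) = (norm (Y k - Y l))\<^sup>2"
        unfolding f(1) by (subst diff_abs_L2) (simp_all add: f norm_abs_L2[OF sq])
      also have "ennreal \<dots> \<le> ennreal (((1/2) ^ k)\<^sup>2)"
        by (intro ennreal_leI power_mono Y \<open>k \<le> l\<close>) simp
      finally show "(\<integral>\<^sup>+t. ennreal ((f k t - f l t)\<^sup>2) \<partial>unit_lborel) \<le> ennreal (((1/2) ^ k)\<^sup>2)" .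
    qed
    finally show ?thesis .
  qed
  have diff: "square_integrable (\<lambda>t. f k t - F t)" for k
    unfolding square_integrable_def
  proof
    show "integrable unit_lborel (\<lambda>t. (f k t - F t)\<^sup>2)"
    proof (rule integrableI_bounded)
      have "(\<integral>\<^sup>+t. ennreal (norm ((f k t - F t)\<^sup>2)) \<partial>unit_lborel) \<le> ennreal (((1/2) ^ k)\<^sup>2)"
        using fatou[of k] by simp
      then show "(\<integral>\<^sup>+t. ennreal (norm ((f k t - F t)\<^sup>2)) \<partial>unit_lborel) < \<infinity>"
        by (rule le_less_trans) simp
    qed simp
  qed simp
  have F: "square_integrable F"
    using square_integrable_diff[OF f(2)[of 0] diff[of 0]] by simp
  have le: "norm (Y k - abs_L2 F) \<le> (1/2) ^ k" for k
  proof -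
    have "ennreal (\<integral>t. (f k t - F t)\<^sup>2 \<partial>unit_lborel)
        = (\<integral>\<^sup>+t. ennreal ((f k t - F t)\<^sup>2) \<partial>unit_lborel)"
      using diff[of k] by (intro nn_integral_eq_integral[symmetric]) (auto simp: square_integrable_def)
    also have "\<dots> \<le> ennreal (((1/2) ^ k)\<^sup>2)"
      by (rule fatou)
    finally have "(\<integral>t. (f k t - F t)\<^sup>2 \<partial>unit_lborel) \<le> ((1/2) ^ k)\<^sup>2"
      by (simp del: ennreal_power)
    moreover have "(\<integral>t. (f k t - F t)\<^sup>2 \<partial>unit_lborel) = (norm (Y k - abs_L2 F))\<^sup>2"
      unfolding f(1) by (subst diff_abs_L2) (simp_all add: f F norm_abs_L2[OF diff])
    ultimately show ?thesis
      by (metis power2_le_imp_le zero_le_power zero_le_divide_1_iff zero_le_numeral)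
  qed
  have "(\<lambda>k. (1/2 :: real) ^ k) \<longlonglongrightarrow> 0"
    by (rule LIMSEQ_power_zero) simp
  then have "(\<lambda>k. Y k - abs_L2 F) \<longlonglongrightarrow> 0"
    by (rule Lim_null_comparison[rotated]) (use le in simp)
  then have "Y \<longlonglongrightarrow> abs_L2 F"
    by (rule LIM_zero_cancel)
  then show ?thesis
    by (auto simp: convergent_def)
qed

instance L2 :: complete_space
proof
  fix X :: "nat \<Rightarrow> L2" assume X: "Cauchy X"
  have "\<forall>k. \<exists>N. \<forall>m\<ge>N. \<forall>n\<ge>N. dist (X m) (X n) < (1/2) ^ k"
    using X by (auto simp: Cauchy_def)
  then obtain N where N: "\<And>k m n. N k \<le> m \<Longrightarrow> N k \<le> n \<Longrightarrow> dist (X m) (X n) < (1/2) ^ k"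
    by metis
  define r where "r k = (\<Sum>i\<le>k. N i) + k" for k
  have r: "strict_mono r"
    by (rule strict_monoI_Suc) (simp add: r_def)
  have rN: "N k \<le> r k" for k
    unfolding r_def using member_le_sum[of k "{..k}" N] by simp
  have "convergent (X \<circ> r)"
  proof (rule L2_fast_Cauchy_converges)
    fix k l :: nat assume "k \<le> l"
    then have "r k \<le> r l"
      using r by (simp add: strict_mono_less_eq)
    then have "dist (X (r k)) (X (r l)) < (1/2) ^ k"
      using rN[of k] by (intro N) auto
    then show "norm ((X \<circ> r) k - (X \<circ> r) l) \<le> (1/2) ^ k"
      by (simp add: dist_norm)
  qed
  then obtain l where "(X \<circ> r) \<longlonglongrightarrow> l"
    by (auto simp: convergent_def)
  then have "X \<longlonglongrightarrow> l"
    using X r by (intro Cauchy_converges_subseq[OF X r])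
  then show "convergent X"
    by (auto simp: convergent_def)
qed

instance L2 :: banach ..

subsection \<open>Separability\<close>

lemma square_integrable_dominated:
  assumes "square_integrable G" "f \<in> borel_measurable unit_lborel"
    "\<And>t. t \<in> {0..1} \<Longrightarrow> \<bar>f t\<bar> \<le> \<bar>G t\<bar>"
  shows "square_integrable f"
  unfolding square_integrable_def
proof
  show "integrable unit_lborel (\<lambda>t. (f t)\<^sup>2)"
  proof (rule Bochner_Integration.integrable_bound)
    show "integrable unit_lborel (\<lambda>t. (G t)\<^sup>2)"
      using assms by (simp add: square_integrable_def)
    show "AE t in unit_lborel. norm ((f t)\<^sup>2) \<le> norm ((G t)\<^sup>2)"
      by (rule AE_I2) (use assms(3) in \<open>simp add: abs_le_square_iff\<close>)
  qed (use assms in simp)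
qed (rule assms)

lemma L2_dominated_convergence:
  assumes G: "square_integrable G" and F: "square_integrable F"
    and f: "\<And>n. f n \<in> borel_measurable unit_lborel"
    and bound: "\<And>n t. t \<in> {0..1} \<Longrightarrow> \<bar>f n t\<bar> \<le> \<bar>G t\<bar>"
    and lim: "\<And>t. t \<in> {0..1} \<Longrightarrow> (\<lambda>n. f n t) \<longlonglongrightarrow> F t"
  shows "(\<lambda>n. abs_L2 (f n)) \<longlonglongrightarrow> abs_L2 F"
proof -
  note [measurable] = f square_integrable_measurable[OF F] square_integrable_measurable[OF G]
  have sf: "square_integrable (f n)" for n
    by (rule square_integrable_dominated[OF G f bound])
  have "square_integrable (\<lambda>t. \<bar>G t\<bar> + \<bar>F t\<bar>)"
    using G F by (intro square_integrable_add) (auto simp: square_integrable_def)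
  then have w: "integrable unit_lborel (\<lambda>t. (\<bar>G t\<bar> + \<bar>F t\<bar>)\<^sup>2)"
    by (simp add: square_integrable_def)
  have "(\<lambda>n. \<integral>t. (f n t - F t)\<^sup>2 \<partial>unit_lborel) \<longlonglongrightarrow> (\<integral>t. 0 \<partial>unit_lborel)"
  proof (rule integral_dominated_convergence[OF _ _ w])
    show "AE t in unit_lborel. (\<lambda>n. (f n t - F t)\<^sup>2) \<longlonglongrightarrow> 0"
    proof (rule AE_I2)
      fix t assume "t \<in> space unit_lborel"
      then have "(\<lambda>n. (f n t - F t)\<^sup>2) \<longlonglongrightarrow> (F t - F t)\<^sup>2"
        by (intro tendsto_intros lim) simp
      then show "(\<lambda>n. (f n t - F t)\<^sup>2) \<longlonglongrightarrow> 0" by simp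
    qed
    show "AE t in unit_lborel. norm ((f n t - F t)\<^sup>2) \<le> (\<bar>G t\<bar> + \<bar>F t\<bar>)\<^sup>2" for n
    proof (rule AE_I2)
      fix t assume "t \<in> space unit_lborel"
      then have "\<bar>f n t - F t\<bar> \<le> \<bar>G t\<bar> + \<bar>F t\<bar>"
        using bound[of t n] by simp
      then have "\<bar>f n t - F t\<bar>\<^sup>2 \<le> (\<bar>G t\<bar> + \<bar>F t\<bar>)\<^sup>2"
        by (rule power_mono) simp
      then show "norm ((f n t - F t)\<^sup>2) \<le> (\<bar>G t\<bar> + \<bar>F t\<bar>)\<^sup>2"
        by simp
    qed
  qed simp_all
  then have "(\<lambda>n. (norm (abs_L2 (f n) - abs_L2 F))\<^sup>2) \<longlonglongrightarrow> 0"
    by (simp add: diff_abs_L2 sf F norm_abs_L2 square_integrable_diff)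
  then have "(\<lambda>n. sqrt ((norm (abs_L2 (f n) - abs_L2 F))\<^sup>2)) \<longlonglongrightarrow> sqrt 0"
    by (rule tendsto_real_sqrt)
  then have "(\<lambda>n. abs_L2 (f n) - abs_L2 F) \<longlonglongrightarrow> 0"
    by (simp add: tendsto_norm_zero_iff)
  then show ?thesis
    by (rule LIM_zero_cancel)
qed

definition indicator_L2 :: "real set \<Rightarrow> L2" where
  "indicator_L2 A = abs_L2 (indicator A)"

lemma square_integrable_indicator:
  "A \<in> sets borel \<Longrightarrow> square_integrable (indicator A)"
  by (rule square_integrable_bounded[where B = 1])
    (auto intro!: measurable_unit_lborel simp: indicator_def)

lemma indicator_L2_empty: "indicator_L2 {} = 0"
  unfolding indicator_L2_def zero_L2_def
  by (intro abs_L2_eqI square_integrable_indicator square_integrable_zero) auto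

lemma indicator_L2_Un:
  assumes "A \<in> sets borel" "B \<in> sets borel" "A \<inter> B = {}"
  shows "indicator_L2 (A \<union> B) = indicator_L2 A + indicator_L2 B"
proof -
  have "(indicator (A \<union> B) :: real \<Rightarrow> real) = (\<lambda>t. indicator A t + indicator B t)"
    using assms(3) by (auto simp: indicator_def fun_eq_iff)
  then show ?thesis
    using assms by (simp add: indicator_L2_def add_abs_L2 square_integrable_indicator)
qed

lemma indicator_L2_tendsto:
  assumes "\<And>n. A n \<in> sets borel" "B \<in> sets borel"
    and "\<And>t. (\<lambda>n. indicator (A n) t :: real) \<longlonglongrightarrow> indicator B t"
  shows "(\<lambda>n. indicator_L2 (A n)) \<longlonglongrightarrow> indicator_L2 B"
  unfolding indicator_L2_def
proof (rule L2_dominated_convergence)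
  show "square_integrable (\<lambda>t. 1)"
    by (rule square_integrable_bounded[where B = 1]) auto
  show "square_integrable (indicator B)"
    by (rule square_integrable_indicator[OF assms(2)])
  show "(indicator (A n) :: real \<Rightarrow> real) \<in> borel_measurable unit_lborel" for n
    by (rule square_integrable_measurable[OF square_integrable_indicator[OF assms(1)]])
  show "\<bar>indicator (A n) t\<bar> \<le> \<bar>1 :: real\<bar>" for n and t :: real
    by (simp add: indicator_def)
qed (rule assms(3))

definition rational_steps :: "L2 set" where
  "rational_steps = range (\<lambda>xs :: (rat \<times> rat) list.
     \<Sum>(q, r)\<leftarrow>xs. (of_rat q :: real) *\<^sub>R indicator_L2 {..of_rat r})"

lemma countable_rational_steps: "countable rational_steps"
  unfolding rational_steps_def by (rule countable_image) simp

lemma rational_steps_add: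
  assumes "x \<in> rational_steps" "y \<in> rational_steps"
  shows "x + y \<in> rational_steps"
proof -
  obtain xs ys where "x = (\<Sum>(q, r)\<leftarrow>xs. (of_rat q :: real) *\<^sub>R indicator_L2 {..of_rat r})"
    "y = (\<Sum>(q, r)\<leftarrow>ys. (of_rat q :: real) *\<^sub>R indicator_L2 {..of_rat r})"
    using assms by (auto simp: rational_steps_def)
  then have "x + y = (\<Sum>(q, r)\<leftarrow>xs @ ys. (of_rat q :: real) *\<^sub>R indicator_L2 {..of_rat r})"
    by simp
  then show ?thesis
    unfolding rational_steps_def by blast
qed

lemma rational_steps_scale:
  assumes "x \<in> rational_steps" "c \<in> \<rat>"
  shows "c *\<^sub>R x \<in> rational_steps"
proof -
  obtain xs where x: "x = (\<Sum>(q, r)\<leftarrow>xs. (of_rat q :: real) *\<^sub>R indicator_L2 {..of_rat r})"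
    using assms by (auto simp: rational_steps_def)
  obtain p where c: "c = of_rat p"
    using assms(2) by (auto elim: Rats_cases)
  have "c *\<^sub>R x = (\<Sum>(q, r)\<leftarrow>map (\<lambda>(q, r). (p * q, r)) xs.
      (of_rat q :: real) *\<^sub>R indicator_L2 {..of_rat r})"
    unfolding x c by (induction xs) (auto simp: scaleR_add_right of_rat_mult)
  then show ?thesis
    unfolding rational_steps_def by blast
qed

lemma closure_rational_steps_add:
  assumes "x \<in> closure rational_steps" "y \<in> closure rational_steps"
  shows "x + y \<in> closure rational_steps"
proof -
  have "(\<lambda>z. fst z + snd z) ` closure (rational_steps \<times> rational_steps) \<subseteq> closure rational_steps"
    by (rule image_closure_subset)
      (auto intro!: continuous_intros rational_steps_add subsetD[OF closure_subset])
  then show ?thesis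
    using assms by (force simp: closure_Times)
qed

lemma closure_rational_steps_scale:
  assumes "x \<in> closure rational_steps"
  shows "c *\<^sub>R x \<in> closure rational_steps"
proof -
  have "(\<lambda>z. fst z *\<^sub>R snd z) ` closure ((\<rat> :: real set) \<times> rational_steps) \<subseteq> closure rational_steps"
    by (rule image_closure_subset)
      (auto intro!: continuous_intros rational_steps_scale subsetD[OF closure_subset])
  moreover have "(c, x) \<in> closure ((\<rat> :: real set) \<times> rational_steps)"
    using assms by (simp add: closure_Times Rats_closure_real)
  ultimately show ?thesis
    by force
qed

lemma closure_rational_steps_diff:
  assumes "x \<in> closure rational_steps" "y \<in> closure rational_steps"
  shows "x - y \<in> closure rational_steps"
  using closure_rational_steps_add[OF assms(1) closure_rational_steps_scale[OF assms(2), of "-1"]]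
  by simp

lemma closure_rational_steps_zero: "0 \<in> closure rational_steps"
proof -
  have "(\<Sum>(q, r)\<leftarrow>([] :: (rat \<times> rat) list). (of_rat q :: real) *\<^sub>R indicator_L2 {..of_rat r})
      \<in> rational_steps"
    unfolding rational_steps_def by blast
  then show ?thesis
    using closure_subset by auto
qed

lemma closure_rational_steps_lim:
  assumes "\<And>n. x n \<in> closure rational_steps" "x \<longlonglongrightarrow> l"
  shows "l \<in> closure rational_steps"
  by (rule closed_sequentially[OF closed_closure assms])

lemma indicator_atMost_in_closure: "indicator_L2 {..a} \<in> closure rational_steps"
proof -
  have rat: "indicator_L2 {..of_rat r} \<in> closure rational_steps" for r
  proof -
    have "(\<Sum>(q, r)\<leftarrow>[(1, r)]. (of_rat q :: real) *\<^sub>R indicator_L2 {..of_rat r}) \<in> rational_steps"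
      unfolding rational_steps_def by blast
    then show ?thesis
      using closure_subset by auto
  qed
  have "\<exists>r. a < of_rat r \<and> of_rat r < a + inverse (Suc n)" for n
    using of_rat_dense[of a "a + inverse (Suc n)"] by simp
  then obtain r where r: "\<And>n. a < of_rat (r n)" "\<And>n. of_rat (r n) < a + inverse (Suc n)"
    by metis
  have rl: "(\<lambda>n. of_rat (r n)) \<longlonglongrightarrow> a"
  proof (rule real_tendsto_sandwich[of "\<lambda>_. a" _ _ "\<lambda>n. a + inverse (Suc n)"])
    show "(\<lambda>n. a + inverse (real (Suc n))) \<longlonglongrightarrow> a"
      by (rule LIMSEQ_inverse_real_of_nat_add)
    show "\<forall>\<^sub>F n in sequentially. a \<le> of_rat (r n)"
      by (intro always_eventually allI less_imp_le r(1))
    show "\<forall>\<^sub>F n in sequentially. of_rat (r n) \<le> a + inverse (Suc n)"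
      by (intro always_eventually allI less_imp_le r(2))
  qed simp
  have "(\<lambda>n. indicator_L2 {..of_rat (r n)}) \<longlonglongrightarrow> indicator_L2 {..a}"
  proof (rule indicator_L2_tendsto)
    fix t :: real
    have "eventually (\<lambda>n. indicator {..of_rat (r n)} t = (indicator {..a} t :: real)) sequentially"
    proof (cases "t \<le> a")
      case True
      then have "t \<le> of_rat (r n)" for n
        using r(1)[of n] by simp
      then show ?thesis
        using True by simp
    next
      case False
      then have "eventually (\<lambda>n. of_rat (r n) < t) sequentially"
        using order_tendstoD(2)[OF rl, of t] by simp
      then show ?thesis
        by eventually_elim (use False in \<open>auto simp: indicator_def\<close>)
    qed
    then show "(\<lambda>n. indicator {..of_rat (r n)} t) \<longlonglongrightarrow> (indicator {..a} t :: real)"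
      by (rule tendsto_eventually)
  qed auto
  then show ?thesis
    by (rule closure_rational_steps_lim[OF rat])
qed

lemma indicator_in_closure:
  assumes "A \<in> sets borel"
  shows "indicator_L2 A \<in> closure rational_steps"
proof -
  have sets: "sets borel = sigma_sets UNIV (range (\<lambda>a::real. {..a}))"
    by (subst borel_eq_atMost) simp
  have "indicator_L2 (UNIV :: real set) = indicator_L2 {..1}"
    unfolding indicator_L2_def by (intro abs_L2_eqI square_integrable_indicator) auto
  then have UNIV: "indicator_L2 UNIV \<in> closure rational_steps"
    using indicator_atMost_in_closure by simp
  have stable: "Int_stable (range (\<lambda>a::real. {..a}))"
    by (auto simp: Int_stable_def)
  have "range (\<lambda>a::real. {..a}) \<subseteq> Pow UNIV"
    by simp
  note stable this
  moreover have "A \<in> sigma_sets UNIV (range (\<lambda>a::real. {..a}))"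
    using assms by (simp add: sets)
  ultimately show ?thesis
  proof (induction rule: sigma_sets_induct_disjoint)
    case (basic A)
    then show ?case
      using indicator_atMost_in_closure by auto
  next
    case empty
    show ?case
      by (simp add: closure_rational_steps_zero indicator_L2_empty)
  next
    case (compl A)
    then have "A \<in> sets borel" by (simp add: sets)
    then have "indicator_L2 (A \<union> (UNIV - A)) = indicator_L2 A + indicator_L2 (UNIV - A)"
      by (intro indicator_L2_Un) auto
    then have "indicator_L2 (UNIV - A) = indicator_L2 UNIV - indicator_L2 A"
      by simp
    then show ?case
      using closure_rational_steps_diff[OF UNIV compl.IH] by simp
  next
    case (union A)
    have A: "A i \<in> sets borel" for i
      using union.hyps by (auto simp: sets)
    have fin: "indicator_L2 (\<Union>i<n. A i) \<in> closure rational_steps" for n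
    proof (induction n)
      case 0
      show ?case
        by (simp add: closure_rational_steps_zero indicator_L2_empty)
    next
      case (Suc n)
      have "A n \<inter> (\<Union>i<n. A i) = {}"
      proof -
        have "A n \<inter> A i = {}" if "i < n" for i
          using disjoint_family_onD[OF union.hyps(1), of n i] that by simp
        then show ?thesis by blast
      qed
      then have "indicator_L2 (A n \<union> (\<Union>i<n. A i)) = indicator_L2 (A n) + indicator_L2 (\<Union>i<n. A i)"
        using A by (intro indicator_L2_Un) auto
      then show ?case
        using closure_rational_steps_add[OF union.IH[of n] Suc] by (simp add: lessThan_Suc)
    qed
    have "(\<lambda>n. indicator_L2 (\<Union>i<n. A i)) \<longlonglongrightarrow> indicator_L2 (\<Union>i. A i)"
      using A by (intro indicator_L2_tendsto LIMSEQ_indicator_UN) auto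
    then show ?case
      by (rule closure_rational_steps_lim[OF fin])
  qed
qed

lemma simple_function_in_closure:
  assumes "finite I" "\<And>i. i \<in> I \<Longrightarrow> B i \<in> sets borel"
  shows "square_integrable (\<lambda>t. \<Sum>i\<in>I. c i * indicator (B i) t) \<and>
    abs_L2 (\<lambda>t. \<Sum>i\<in>I. c i * indicator (B i) t) \<in> closure rational_steps"
  using assms
proof (induction I rule: finite_induct)
  case empty
  then show ?case
    using closure_rational_steps_zero square_integrable_zero by (simp add: zero_L2_def)
next
  case (insert i I)
  have sq: "square_integrable (\<lambda>t. c i * indicator (B i) t)"
    "square_integrable (\<lambda>t. \<Sum>i\<in>I. c i * indicator (B i) t)"
    using insert by (auto intro!: square_integrable_scale square_integrable_indicator)
  have "abs_L2 (\<lambda>t. c i * indicator (B i) t) = c i *\<^sub>R indicator_L2 (B i)"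
    unfolding indicator_L2_def
    by (subst scaleR_abs_L2) (use insert in \<open>auto intro!: square_integrable_indicator\<close>)
  then have "abs_L2 (\<lambda>t. c i * indicator (B i) t) \<in> closure rational_steps"
    using insert by (auto intro!: closure_rational_steps_scale indicator_in_closure)
  moreover have "abs_L2 (\<lambda>t. \<Sum>i\<in>I. c i * indicator (B i) t) \<in> closure rational_steps"
    using insert by auto
  ultimately have "abs_L2 (\<lambda>t. c i * indicator (B i) t + (\<Sum>i\<in>I. c i * indicator (B i) t))
      \<in> closure rational_steps"
    unfolding add_abs_L2[OF sq, symmetric] by (rule closure_rational_steps_add)
  then show ?case
    using square_integrable_add[OF sq] by (simp only: sum.insert[OF insert(1,2)])
qed

lemma closure_rational_steps: "closure rational_steps = UNIV"
proof (rule UNIV_eq_I[symmetric])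
  fix x :: L2
  obtain f where x: "x = abs_L2 f" and f: "square_integrable f"
    by (rule L2_cases)
  have "f \<in> borel_measurable unit_lborel"
    using f by (rule square_integrable_measurable)
  from borel_measurable_implies_sequence_metric[OF this, of 0]
  obtain s where "\<forall>i. simple_function unit_lborel (s i)"
      "\<forall>t\<in>space unit_lborel. (\<lambda>i. s i t) \<longlonglongrightarrow> f t"
      "\<forall>i. \<forall>t\<in>space unit_lborel. dist (s i t) 0 \<le> 2 * dist (f t) 0"
    by blast
  then have s: "simple_function unit_lborel (s i)"
      "t \<in> {0..1} \<Longrightarrow> (\<lambda>i. s i t) \<longlonglongrightarrow> f t"
      "t \<in> {0..1} \<Longrightarrow> \<bar>s i t\<bar> \<le> 2 * \<bar>f t\<bar>" for i t
    by auto
  have sm: "s i \<in> borel_measurable unit_lborel" for i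
    using s(1) by (rule borel_measurable_simple_function)
  have "(\<lambda>i. abs_L2 (s i)) \<longlonglongrightarrow> x"
    unfolding x using s sm f
    by (intro L2_dominated_convergence[of "\<lambda>t. 2 * f t"])
      (auto intro!: square_integrable_scale simp: abs_mult)
  moreover have "abs_L2 (s i) \<in> closure rational_steps" for i
  proof -
    let ?B = "\<lambda>y. s i -` {y} \<inter> {0..1}"
    have "?B y \<in> sets unit_lborel" for y
      using simple_functionD(2)[OF s(1)[of i], of "{y}"] by simp
    then have B: "?B y \<in> sets borel" for y
      by (simp add: unit_lborel_def sets_restrict_space_iff)
    have fin: "finite (s i ` {0..1})"
      using simple_functionD(1)[OF s(1)[of i]] by simp
    let ?S = "\<lambda>t. \<Sum>y\<in>s i ` {0..1}. y * indicator (?B y) t"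
    have S: "square_integrable ?S" "abs_L2 ?S \<in> closure rational_steps"
      using simple_function_in_closure[of "s i ` {0..1}" ?B "\<lambda>y. y"] fin B by auto
    have "square_integrable (s i)"
      by (rule square_integrable_dominated[OF square_integrable_scale[OF f, of 2] sm])
        (use s(3) in \<open>simp add: abs_mult\<close>)
    then have "abs_L2 (s i) = abs_L2 ?S"
    proof (rule abs_L2_eqI[OF _ S(1)])
      fix t :: real assume "t \<in> {0..1}"
      then have "s i t = (\<Sum>y\<in>s i ` space unit_lborel.
          indicator (s i -` {y} \<inter> space unit_lborel) t *\<^sub>R y)"
        by (intro simple_function_indicator_representation_banach s(1)) simp
      also have "\<dots> = ?S t"
        by (simp only: space_unit_lborel real_scaleR_def mult.commute[of "indicator _ _"])
      finally show "s i t = ?S t" .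
    qed
    then show ?thesis
      using S(2) by simp
  qed
  ultimately show "x \<in> closure rational_steps"
    by (rule closure_rational_steps_lim[rotated])
qed

instance L2 :: second_countable_topology
proof
  define \<B> where "\<B> = (\<lambda>(x, n::nat). ball x (inverse (Suc n))) ` (rational_steps \<times> UNIV)"
  have "countable \<B>"
    unfolding \<B>_def by (intro countable_image countable_SIGMA countable_rational_steps) simp
  moreover have "topological_basis \<B>"
  proof (rule topological_basisI)
    show "open U" if "U \<in> \<B>" for U
      using that by (auto simp: \<B>_def)
    fix U and x :: L2 assume "open U" "x \<in> U"
    then obtain e where e: "e > 0" "ball x e \<subseteq> U"
      by (meson open_contains_ball)
    obtain n where n: "inverse (real (Suc n)) < e / 2"
      using reals_Archimedean[of "e / 2"] e(1) by auto
    have "x \<in> closure rational_steps"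
      by (simp add: closure_rational_steps)
    then obtain d where d: "d \<in> rational_steps" "dist d x < inverse (real (Suc n))"
      unfolding closure_approachable by (metis inverse_positive_iff_positive of_nat_0_less_iff zero_less_Suc)
    have "ball d (inverse (Suc n)) \<subseteq> ball x e"
    proof
      fix y assume "y \<in> ball d (inverse (Suc n))"
      then show "y \<in> ball x e"
        using d(2) n dist_triangle[of x y d] by (simp add: dist_commute)
    qed
    then show "\<exists>V\<in>\<B>. x \<in> V \<and> V \<subseteq> U"
      using d e(2) by (intro bexI[of _ "ball d (inverse (Suc n))"]) (auto simp: \<B>_def)
  qed
  ultimately show "\<exists>B::L2 set set. countable B \<and> open = generate_topology B"
    using topological_basis_imp_subbasis by blast
qed


section \<open>Approximable sequences\<close>

definition Lp :: "'a measure \<Rightarrow> real \<Rightarrow> ('a \<Rightarrow> 'h::real_normed_vector) set" where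
  "Lp M p = {Y \<in> borel_measurable M. integrable M (\<lambda>\<omega>. norm (Y \<omega>) powr p)}"

text \<open>This is \<open>(E \<parallel>Y\<parallel>\<^sup>p)\<^bsup>1/p\<^esup>\<close> for \<open>Y \<in> Lp M p\<close> only: a divergent integral is \<open>0\<close> by the library's
  convention, so finiteness of \<open>\<nu>\<^sub>p\<close> is always expressed by membership in \<^const>\<open>Lp\<close>.\<close>

definition nu :: "'a measure \<Rightarrow> real \<Rightarrow> ('a \<Rightarrow> 'h::real_normed_vector) \<Rightarrow> real" where
  "nu M p Y = (\<integral>\<omega>. norm (Y \<omega>) powr p \<partial>M) powr (1 / p)"

definition iid :: "'a measure \<Rightarrow> 's measure \<Rightarrow> (int \<Rightarrow> 'a \<Rightarrow> 's) \<Rightarrow> bool" where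
  "iid M S \<epsilon> \<longleftrightarrow>
     prob_space.indep_vars M (\<lambda>_. S) \<epsilon> UNIV \<and> (\<forall>i. distr M S (\<epsilon> i) = distr M S (\<epsilon> 0))"

text \<open>The processes \<open>\<epsilon>\<close> (index \<open>None\<close>) and \<open>\<epsilon>' n\<close> (index \<open>Some n\<close>), as random elements of the
  sequence space, are independent, and each \<open>\<epsilon>' n\<close> has the law of \<open>\<epsilon>\<close>.\<close>

definition independent_copies ::
    "'b measure \<Rightarrow> 's measure \<Rightarrow> (int \<Rightarrow> 'b \<Rightarrow> 's) \<Rightarrow> (int \<Rightarrow> int \<Rightarrow> 'b \<Rightarrow> 's) \<Rightarrow> bool" where
  "independent_copies N S \<epsilon> \<epsilon>' \<longleftrightarrow>
     prob_space.indep_vars N (\<lambda>_. Pi\<^sub>M UNIV (\<lambda>_. S))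
       (case_option (\<lambda>\<omega> k. \<epsilon> k \<omega>) (\<lambda>n \<omega> k. \<epsilon>' n k \<omega>)) UNIV \<and>
     (\<forall>n. distr N (Pi\<^sub>M UNIV (\<lambda>_. S)) (\<lambda>\<omega> k. \<epsilon>' n k \<omega>) =
          distr N (Pi\<^sub>M UNIV (\<lambda>_. S)) (\<lambda>\<omega> k. \<epsilon> k \<omega>))"

definition coupled ::
    "((nat \<Rightarrow> 's) \<Rightarrow> 'h) \<Rightarrow> (int \<Rightarrow> 'b \<Rightarrow> 's) \<Rightarrow> (int \<Rightarrow> int \<Rightarrow> 'b \<Rightarrow> 's) \<Rightarrow> nat \<Rightarrow> int \<Rightarrow> 'b \<Rightarrow> 'h" where
  "coupled f \<epsilon> \<epsilon>' m n \<omega> =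
     f (\<lambda>i. if i < m then \<epsilon> (n - int i) \<omega> else \<epsilon>' n (n - int i) \<omega>)"

text \<open>The copies need not exist on \<open>M\<close> itself, so they live on an extension \<open>N\<close> of it, that is, a
  probability space with a measure-preserving map \<open>\<pi>\<close> to \<open>M\<close> along which \<open>X\<close> and \<open>\<epsilon>\<close> are lifted.
  The coupled differences depend on \<open>N\<close> only through the joint law of \<open>\<epsilon>\<close> and its copies,
  which is determined by that of \<open>\<epsilon>\<close>; the choice of \<open>N\<close> and of the type of its points
  (large enough for the product extension) is therefore immaterial. The type argument fixes the
  points of the state space \<open>S\<close> of the innovations.\<close>

definition Lp_m_approximable ::
    "'s itself \<Rightarrow> real \<Rightarrow> 'a measure \<Rightarrow> (int \<Rightarrow> 'a \<Rightarrow> 'h::real_normed_vector) \<Rightarrow> bool" where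
  "Lp_m_approximable (_ :: 's itself) p M X \<longleftrightarrow>
     (\<forall>n. X n \<in> Lp M p) \<and>
     (\<exists>(S :: 's measure) \<epsilon> f.
        iid M S \<epsilon> \<and>
        f \<in> borel_measurable (Pi\<^sub>M (UNIV :: nat set) (\<lambda>_. S)) \<and>
        (\<forall>n. AE \<omega> in M. X n \<omega> = f (\<lambda>i. \<epsilon> (n - int i) \<omega>)) \<and>
        (\<exists>(N :: ('a \<times> (int \<Rightarrow> int \<Rightarrow> 's)) measure) \<pi> \<epsilon>'.
           prob_space N \<and> \<pi> \<in> measurable N M \<and> distr N M \<pi> = M \<and>
           independent_copies N S (\<lambda>k. \<epsilon> k \<circ> \<pi>) \<epsilon>' \<and>
           (\<forall>m\<ge>1. (\<lambda>\<omega>. X (int m) (\<pi> \<omega>) - coupled f (\<lambda>k. \<epsilon> k \<circ> \<pi>) \<epsilon>' m (int m) \<omega>) \<in> Lp N p) \<and>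
           summable (\<lambda>m. nu N p (\<lambda>\<omega>. X (int (Suc m)) (\<pi> \<omega>) -
             coupled f (\<lambda>k. \<epsilon> k \<circ> \<pi>) \<epsilon>' (Suc m) (int (Suc m)) \<omega>))))"

end

theory Submission
  imports Defs
begin

text \<open>
  Take \<open>f s = (\<Sum>j. \<Psi> j (s j))\<close>. The coupled variable \<open>X\<^sub>m\<^sup>(\<^sup>m\<^sup>)\<close> agrees with \<open>X\<^sub>m\<close> in the first
  \<open>m\<close> innovations, so the terms with \<open>j < m\<close> cancel and, with \<open>\<epsilon>'\<close> the copy of \<open>\<epsilon>\<close> used at
  time \<open>m\<close>,
  \<open>X\<^sub>m - X\<^sub>m\<^sup>(\<^sup>m\<^sup>) = (\<Sum>j\<ge>m. \<Psi> j (\<epsilon> (m - j) - \<epsilon>' (m - j)))\<close>.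
  All the differences on the right have \<open>\<nu>\<^sub>p\<close> at most \<open>2 \<nu>\<^sub>p(\<epsilon> 0)\<close>, hence the left-hand side has
  \<open>\<nu>\<^sub>p\<close> at most \<open>2 \<nu>\<^sub>p(\<epsilon> 0) (\<Sum>j\<ge>m. \<parallel>\<Psi> j\<parallel>)\<close>, which is summable over \<open>m\<close> by hypothesis.

  The bound \<open>\<nu>\<^sub>p (\<Sum>i. L i (Y i)) \<le> (\<Sum>i. \<parallel>L i\<parallel>) C\<close>, for \<open>Y i\<close> with \<open>\<nu>\<^sub>p (Y i) \<le> C\<close>, is a case of
  Minkowski's inequality. Because the bound on \<open>Y i\<close> is uniform in \<open>i\<close>, it already follows
  from the convexity of \<open>x \<mapsto> x\<^sup>p\<close>: pointwise, \<open>(\<Sum>i. a i * x i)\<^sup>p \<le> A\<^sup>p\<^sup>-\<^sup>1 (\<Sum>i. a i * (x i)\<^sup>p)\<close> with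
  \<open>A = (\<Sum>i. a i)\<close> (lemma \<open>powr_suminf_le\<close>), and then the expectation is taken term by term
  (lemma \<open>nu_operator_series_le\<close>). The same bound gives \<open>X n \<in> L\<^sup>p\<close> and the almost sure
  convergence of the coupled series, on which the cancellation relies.

  The copies live on the product of \<open>M\<close> with countably many copies of the law of the whole
  sequence \<open>\<epsilon>\<close> (lemma \<open>independent_copies_product\<close>).
\<close>

section \<open>Moments of weighted series\<close>

lemma powr_above_tangent:
  fixes x c p :: real
  assumes "1 \<le> p" "0 < c" "0 \<le> x"
  shows "c powr p + p * c powr (p - 1) * (x - c) \<le> x powr p"
proof (cases "x = 0")
  case True
  have "c powr (p - 1) * c = c powr p"
    using assms by (simp add: powr_mult_base mult.commute)
  then have "c powr p + p * c powr (p - 1) * (x - c) = (1 - p) * c powr p"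
    using True by (simp add: algebra_simps)
  also have "\<dots> \<le> 0"
    using assms by (simp add: mult_nonpos_nonneg)
  finally show ?thesis
    using True by simp
next
  case False
  have "p * c powr (p - 1) * (x - c) \<le> x powr p - c powr p"
    using assms False
    by (intro convex_on_imp_above_tangent[where A = "{0<..}"] powr_convex)
      (auto intro!: derivative_eq_intros simp: interior_open connected_Ioi)
  then show ?thesis by simp
qed

text \<open>Jensen's inequality for the weights \<open>a i\<close>, without normalising them. The proof sums the
  tangent inequality, so that infinitely many weights cost no limit argument.\<close>

lemma powr_suminf_le:
  fixes a x :: "nat \<Rightarrow> real"
  assumes p: "1 \<le> p" and a: "summable a" "\<And>i. 0 \<le> a i" and x: "\<And>i. 0 \<le> x i"
    and ax: "summable (\<lambda>i. a i * x i powr p)"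
  shows "summable (\<lambda>i. a i * x i)"
    and "(\<Sum>i. a i * x i) powr p \<le> (\<Sum>i. a i) powr (p - 1) * (\<Sum>i. a i * x i powr p)"
proof -
  have "a i * x i \<le> a i + a i * x i powr p" for i
  proof -
    have "x i \<le> 1 + x i powr p"
    proof (cases "x i \<le> 1")
      case True
      then show ?thesis using powr_ge_zero[of "x i" p] by linarith
    next
      case False
      then show ?thesis using powr_mono[of 1 p "x i"] p by simp
    qed
    then show ?thesis
      using mult_left_mono[of "x i" "1 + x i powr p" "a i"] a(2) by (simp add: distrib_left)
  qed
  then show *: "summable (\<lambda>i. a i * x i)"
    using a x by (intro summable_comparison_test'[OF summable_add[OF a(1) ax], of 0]) simp
  define A S where "A = (\<Sum>i. a i)" and "S = (\<Sum>i. a i * x i)"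
  have "0 \<le> A" "0 \<le> S"
    unfolding A_def S_def using a x * by (auto intro!: suminf_nonneg)
  have T: "0 \<le> (\<Sum>i. a i * x i powr p)"
    using a ax by (intro suminf_nonneg) auto
  show "S powr p \<le> A powr (p - 1) * (\<Sum>i. a i * x i powr p)"
  proof (cases "S = 0")
    case True
    then show ?thesis using T by simp
  next
    case False
    then have "0 < S" using \<open>0 \<le> S\<close> by simp
    have "A \<noteq> 0"
    proof
      assume "A = 0"
      then have "a i = 0" for i
        using suminf_eq_zero_iff[OF a] by (auto simp: A_def)
      then show False using False by (simp add: S_def)
    qed
    then have "0 < A" using \<open>0 \<le> A\<close> by simp
    \<comment> \<open>The tangent at the weighted mean has no linear part after averaging.\<close>
    define c where "c = S / A"
    have c: "0 < c" "S = A * c"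
      using \<open>0 < A\<close> \<open>0 < S\<close> by (auto simp: c_def)
    let ?k = "p * c powr (p - 1)"
    have "(\<lambda>i. a i * c powr p + ?k * (a i * x i - a i * c)) sums (A * c powr p + ?k * (S - A * c))"
      unfolding A_def S_def using a(1) * by (intro sums_add sums_mult sums_diff sums_mult2 summable_sums)
    then have "(\<lambda>i. a i * (c powr p + ?k * (x i - c))) sums (A * c powr p)"
      using c by (simp add: algebra_simps)
    then have "A * c powr p \<le> (\<Sum>i. a i * x i powr p)"
      by (rule sums_le[rotated, OF _ summable_sums[OF ax]])
        (use a(2) x c p in \<open>auto intro!: mult_left_mono powr_above_tangent\<close>)
    then have "A powr (p - 1) * (A * c powr p) \<le> A powr (p - 1) * (\<Sum>i. a i * x i powr p)"
      by (intro mult_left_mono) auto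
    moreover have "A powr (p - 1) * (A * c powr p) = S powr p"
      using c \<open>0 < A\<close> by (simp add: powr_mult powr_diff)
    ultimately show ?thesis by simp
  qed
qed

lemma nu_le_iff:
  assumes "0 < p" "0 \<le> C"
  shows "nu M p Y \<le> C \<longleftrightarrow> (\<integral>\<omega>. norm (Y \<omega>) powr p \<partial>M) \<le> C powr p"
proof -
  have I: "0 \<le> (\<integral>\<omega>. norm (Y \<omega>) powr p \<partial>M)" by simp
  have "nu M p Y powr p = (\<integral>\<omega>. norm (Y \<omega>) powr p \<partial>M)"
    using assms I by (simp add: nu_def powr_powr)
  moreover have "0 \<le> nu M p Y" by (simp add: nu_def)
  ultimately show ?thesis
    using assms by (metis less_imp_le not_le powr_less_mono2 powr_mono2)
qed

text \<open>The right-hand side of Jensen's inequality is a series of nonnegative functions, so that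
  Tonelli's theorem both computes its integral and makes it finite almost everywhere.\<close>

lemma AE_summable_weighted_moments:
  fixes Y :: "nat \<Rightarrow> 'a \<Rightarrow> 'h::real_normed_vector"
  assumes p: "1 \<le> p" and C: "0 \<le> C"
    and Y: "\<And>i. Y i \<in> Lp M p" "\<And>i. nu M p (Y i) \<le> C"
    and a: "summable a" "\<And>i. 0 \<le> a i"
  shows "AE \<omega> in M. summable (\<lambda>i. a i * norm (Y i \<omega>) powr p)"
    and "(\<integral>\<^sup>+\<omega>. ennreal (\<Sum>i. a i * norm (Y i \<omega>) powr p) \<partial>M) \<le> ennreal ((\<Sum>i. a i) * C powr p)"
proof -
  have [measurable]: "Y i \<in> borel_measurable M" for i
    using Y(1) by (simp add: Lp_def)
  have "(\<integral>\<^sup>+\<omega>. ennreal (a i * norm (Y i \<omega>) powr p) \<partial>M) \<le> ennreal (a i * C powr p)" for i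
  proof -
    have int: "integrable M (\<lambda>\<omega>. a i * norm (Y i \<omega>) powr p)"
      using Y(1)[of i] by (simp add: Lp_def)
    have "(\<integral>\<^sup>+\<omega>. ennreal (a i * norm (Y i \<omega>) powr p) \<partial>M) = ennreal (a i * (\<integral>\<omega>. norm (Y i \<omega>) powr p \<partial>M))"
      using a by (subst nn_integral_eq_integral[OF int]) auto
    also have "\<dots> \<le> ennreal (a i * C powr p)"
      using Y(2)[of i] a(2) p C by (intro ennreal_leI mult_left_mono) (auto simp: nu_le_iff)
    finally show ?thesis .
  qed
  then have "(\<integral>\<^sup>+\<omega>. (\<Sum>i. ennreal (a i * norm (Y i \<omega>) powr p)) \<partial>M) \<le> (\<Sum>i. ennreal (a i * C powr p))"
    by (subst nn_integral_suminf) (auto intro!: suminf_le)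
  also have "\<dots> = ennreal ((\<Sum>i. a i) * C powr p)"
    using a by (intro suminf_ennreal_eq) (auto intro!: sums_mult2)
  finally have le: "(\<integral>\<^sup>+\<omega>. (\<Sum>i. ennreal (a i * norm (Y i \<omega>) powr p)) \<partial>M)
      \<le> ennreal ((\<Sum>i. a i) * C powr p)" .
  then have "(\<integral>\<^sup>+\<omega>. (\<Sum>i. ennreal (a i * norm (Y i \<omega>) powr p)) \<partial>M) \<noteq> \<infinity>"
    by (auto simp: top_unique)
  then have "AE \<omega> in M. (\<Sum>i. ennreal (a i * norm (Y i \<omega>) powr p)) \<noteq> \<infinity>"
    by (intro nn_integral_PInf_AE) auto
  then show AE: "AE \<omega> in M. summable (\<lambda>i. a i * norm (Y i \<omega>) powr p)"
    by eventually_elim (rule summable_suminf_not_top, use a in auto)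
  have "(\<integral>\<^sup>+\<omega>. ennreal (\<Sum>i. a i * norm (Y i \<omega>) powr p) \<partial>M)
      = (\<integral>\<^sup>+\<omega>. (\<Sum>i. ennreal (a i * norm (Y i \<omega>) powr p)) \<partial>M)"
  proof (intro nn_integral_cong_AE)
    show "AE \<omega> in M. ennreal (\<Sum>i. a i * norm (Y i \<omega>) powr p)
        = (\<Sum>i. ennreal (a i * norm (Y i \<omega>) powr p))"
      using AE by eventually_elim (use a in \<open>simp add: suminf_ennreal2\<close>)
  qed
  with le show "(\<integral>\<^sup>+\<omega>. ennreal (\<Sum>i. a i * norm (Y i \<omega>) powr p) \<partial>M) \<le> ennreal ((\<Sum>i. a i) * C powr p)"
    by simp
qed

text \<open>With summable weights, convergence of the weighted \<open>p\<close>-th powers, which holds almost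
  surely, forces convergence of the weighted norms.\<close>

lemma AE_summable_norm_operator_series:
  fixes Y :: "nat \<Rightarrow> 'a \<Rightarrow> 'h::real_normed_vector" and L :: "nat \<Rightarrow> 'h \<Rightarrow>\<^sub>L 'g::real_normed_vector"
  assumes p: "1 \<le> p" and C: "0 \<le> C"
    and Y: "\<And>i. Y i \<in> Lp M p" "\<And>i. nu M p (Y i) \<le> C"
    and L: "summable (\<lambda>i. norm (L i))"
  shows "AE \<omega> in M. summable (\<lambda>i. norm (L i (Y i \<omega>)))"
  using AE_summable_weighted_moments(1)[of p C Y M "\<lambda>i. norm (L i)", OF p C Y L norm_ge_zero]
proof eventually_elim
  case (elim \<omega>)
  have "summable (\<lambda>i. norm (L i) * norm (Y i \<omega>))"
    by (rule powr_suminf_le(1)[OF p L _ _ elim]) auto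
  then show ?case
    by (rule summable_comparison_test'[of _ 0]) (simp add: norm_blinfun)
qed

text \<open>Jensen contributes the factor \<open>A\<^sup>p\<^sup>-\<^sup>1\<close> and the term-by-term integral the factor \<open>A * C\<^sup>p\<close>, where
  \<open>A\<close> is the sum of the operator norms; together they make \<open>(A * C)\<^sup>p\<close>.\<close>

lemma nu_operator_series_le:
  fixes Y :: "nat \<Rightarrow> 'a \<Rightarrow> 'h::real_normed_vector" and L :: "nat \<Rightarrow> 'h \<Rightarrow>\<^sub>L 'g::banach"
  assumes p: "1 \<le> p" and C: "0 \<le> C"
    and Y: "\<And>i. Y i \<in> Lp M p" "\<And>i. nu M p (Y i) \<le> C"
    and L: "summable (\<lambda>i. norm (L i))"
    and Z: "Z \<in> borel_measurable M" "AE \<omega> in M. (\<lambda>i. L i (Y i \<omega>)) sums Z \<omega>"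
  shows "Z \<in> Lp M p" and "nu M p Z \<le> (\<Sum>i. norm (L i)) * C"
proof -
  let ?A = "\<Sum>i. norm (L i)"
  note [measurable] = Z(1)
  have A: "0 \<le> ?A" using L by (intro suminf_nonneg) auto
  have [measurable]: "Y i \<in> borel_measurable M" for i
    using Y(1) by (simp add: Lp_def)
  have "AE \<omega> in M. ennreal (norm (Z \<omega>) powr p)
      \<le> ennreal (?A powr (p - 1)) * ennreal (\<Sum>i. norm (L i) * norm (Y i \<omega>) powr p)"
    using Z(2) AE_summable_weighted_moments(1)[of p C Y M "\<lambda>i. norm (L i)", OF p C Y L norm_ge_zero]
  proof eventually_elim
    case (elim \<omega>)
    have s: "summable (\<lambda>i. norm (L i) * norm (Y i \<omega>))"
      by (rule powr_suminf_le(1)[OF p L _ _ elim(2)]) auto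
    have "norm (Z \<omega>) \<le> (\<Sum>i. norm (L i) * norm (Y i \<omega>))"
      by (rule norm_sums_le[OF elim(1) summable_sums[OF s]]) (rule norm_blinfun)
    then have "norm (Z \<omega>) powr p \<le> (\<Sum>i. norm (L i) * norm (Y i \<omega>)) powr p"
      using p by (intro powr_mono2) auto
    also have "\<dots> \<le> ?A powr (p - 1) * (\<Sum>i. norm (L i) * norm (Y i \<omega>) powr p)"
      by (rule powr_suminf_le(2)[OF p L _ _ elim(2)]) auto
    finally show ?case
      by (subst ennreal_mult''[symmetric])
        (auto intro!: ennreal_leI suminf_nonneg elim)
  qed
  then have "(\<integral>\<^sup>+\<omega>. ennreal (norm (Z \<omega>) powr p) \<partial>M)
      \<le> (\<integral>\<^sup>+\<omega>. ennreal (?A powr (p - 1)) * ennreal (\<Sum>i. norm (L i) * norm (Y i \<omega>) powr p) \<partial>M)"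
    by (rule nn_integral_mono_AE)
  also have "\<dots> = ennreal (?A powr (p - 1)) * (\<integral>\<^sup>+\<omega>. ennreal (\<Sum>i. norm (L i) * norm (Y i \<omega>) powr p) \<partial>M)"
    by (rule nn_integral_cmult) measurable
  also have "\<dots> \<le> ennreal (?A powr (p - 1)) * ennreal (?A * C powr p)"
    by (intro mult_left_mono AE_summable_weighted_moments(2)[OF p C Y L]) auto
  also have "\<dots> = ennreal ((?A * C) powr p)"
    using A C by (cases "?A = 0") (simp_all add: ennreal_mult'[symmetric] powr_mult powr_diff)
  finally have le: "(\<integral>\<^sup>+\<omega>. ennreal (norm (Z \<omega>) powr p) \<partial>M) \<le> ennreal ((?A * C) powr p)" .
  have int: "integrable M (\<lambda>\<omega>. norm (Z \<omega>) powr p)"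
    using le by (intro integrableI_bounded) (auto intro: le_less_trans)
  then show "Z \<in> Lp M p" by (simp add: Lp_def)
  have "(\<integral>\<omega>. norm (Z \<omega>) powr p \<partial>M) \<le> (?A * C) powr p"
    using le by (subst (asm) nn_integral_eq_integral[OF int]) auto
  then show "nu M p Z \<le> ?A * C"
    using p A C by (simp add: nu_le_iff)
qed

text \<open>A difference is an operator series with the two coefficients \<open>id\<close> and \<open>- id\<close>, which gives
  the triangle inequality with a common bound \<open>C\<close>.\<close>

lemma Lp_diff:
  fixes Y Z :: "'a \<Rightarrow> 'h::{banach, second_countable_topology}"
  assumes p: "1 \<le> p" and C: "0 \<le> C"
    and Y: "Y \<in> Lp M p" "nu M p Y \<le> C" and Z: "Z \<in> Lp M p" "nu M p Z \<le> C"
  shows "(\<lambda>\<omega>. Y \<omega> - Z \<omega>) \<in> Lp M p" and "nu M p (\<lambda>\<omega>. Y \<omega> - Z \<omega>) \<le> 2 * C"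
proof -
  define L :: "nat \<Rightarrow> 'h \<Rightarrow>\<^sub>L 'h" where
    "L i = (if i = 0 then id_blinfun else if i = 1 then - id_blinfun else 0)" for i
  define W where "W i = (if i = 0 then Y else Z)" for i :: nat
  have [measurable]: "Y \<in> borel_measurable M" "Z \<in> borel_measurable M"
    using Y Z by (auto simp: Lp_def)
  have sums: "(\<lambda>i. L i (W i \<omega>)) sums (Y \<omega> - Z \<omega>)" for \<omega>
    using sums_finite[of "{0, 1::nat}" "\<lambda>i. L i (W i \<omega>)"]
    by (simp add: L_def W_def blinfun.minus_left)
  have nsums: "(\<lambda>i. norm (L i)) sums (\<Sum>i\<in>{0, 1}. norm (L i))"
    by (rule sums_finite) (auto simp: L_def)
  have W: "W i \<in> Lp M p" "nu M p (W i) \<le> C" for i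
    using Y Z by (auto simp: W_def)
  have D: "(\<lambda>\<omega>. Y \<omega> - Z \<omega>) \<in> borel_measurable M" by measurable
  note series = nu_operator_series_le[OF p C W sums_summable[OF nsums] D AE_I2[OF sums]]
  show "(\<lambda>\<omega>. Y \<omega> - Z \<omega>) \<in> Lp M p" by (rule series(1))
  have "(\<Sum>i. norm (L i)) \<le> 2"
    using norm_blinfun_id_le[where 'a = 'h] sums_unique[OF nsums] by (simp add: L_def)
  then show "nu M p (\<lambda>\<omega>. Y \<omega> - Z \<omega>) \<le> 2 * C"
    using series(2) mult_right_mono[of "\<Sum>i. norm (L i)" 2 C] C by linarith
qed

lemma Lp_nu_cong_law:
  fixes Y :: "'a \<Rightarrow> 'h::{real_normed_vector, second_countable_topology}"
  assumes Y: "Y \<in> borel_measurable M" and Z: "Z \<in> borel_measurable N"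
    and law: "distr M borel Y = distr N borel Z"
  shows "Y \<in> Lp M p \<longleftrightarrow> Z \<in> Lp N p" and "nu M p Y = nu N p Z"
proof -
  have n: "(\<lambda>x::'h. norm x powr p) \<in> borel_measurable borel" by measurable
  show "Y \<in> Lp M p \<longleftrightarrow> Z \<in> Lp N p"
    using integrable_distr_eq[OF Y n] integrable_distr_eq[OF Z n] Y Z
    by (simp add: Lp_def law)
  show "nu M p Y = nu N p Z"
    using integral_distr[OF Y n] integral_distr[OF Z n] by (simp add: nu_def law)
qed

section \<open>Independent copies on a product extension\<close>

lemma (in prob_space) distr_pair_snd:
  assumes "sigma_finite_measure N"
  shows "distr (M \<Otimes>\<^sub>M N) N snd = N"
proof (rule measure_eqI)
  interpret N: sigma_finite_measure N by fact
  fix A assume "A \<in> sets (distr (M \<Otimes>\<^sub>M N) N snd)"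
  then have A: "A \<in> sets N" by simp
  have "snd -` A \<inter> space (M \<Otimes>\<^sub>M N) = space M \<times> A"
    using sets.sets_into_space[OF A] by (auto simp: space_pair_measure)
  then show "emeasure (distr (M \<Otimes>\<^sub>M N) N snd) A = emeasure N A"
    using A by (simp add: emeasure_distr N.emeasure_pair_measure_Times emeasure_space_1)
qed simp

text \<open>Taking \<open>Q\<close> to be the law of the sequence \<open>\<epsilon>\<close> as a whole makes each coordinate of the
  product an exact copy of it. Independence is checked on preimages: a finite intersection of
  preimages under the sequences is a rectangle \<open>U \<times> V\<close>, with \<open>U\<close> constraining \<open>\<epsilon>\<close> alone and
  \<open>V\<close> a finite-dimensional cylinder in the product of the \<open>Q\<close>.\<close>

lemma independent_copies_product:
  fixes M :: "'a measure" and S :: "'s measure"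
  assumes M: "prob_space M" and \<epsilon>[measurable]: "\<And>k. \<epsilon> k \<in> measurable M S"
  defines "Q \<equiv> distr M (Pi\<^sub>M UNIV (\<lambda>_. S)) (\<lambda>\<omega> k. \<epsilon> k \<omega>)"
  defines "N \<equiv> M \<Otimes>\<^sub>M Pi\<^sub>M UNIV (\<lambda>_::int. Q)"
  shows "prob_space N" and "distr N M fst = M"
    and "distr N Q (\<lambda>\<omega>. snd \<omega> n) = Q"
    and "independent_copies N S (\<lambda>k. \<epsilon> k \<circ> fst) (\<lambda>n k \<omega>. snd \<omega> n k)"
proof -
  let ?P = "Pi\<^sub>M UNIV (\<lambda>_::int. Q)" and ?R = "Pi\<^sub>M UNIV (\<lambda>_::int. S)"
  interpret M: prob_space M by (rule M)
  have meas[measurable]: "(\<lambda>\<omega> k. \<epsilon> k \<omega>) \<in> measurable M ?R"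
    by (rule measurable_PiM_single') (auto simp: measurable_space[OF \<epsilon>])
  interpret Q: prob_space Q
    unfolding Q_def by (rule M.prob_space_distr) measurable
  interpret P: product_prob_space "\<lambda>_::int. Q" UNIV ..
  interpret N: pair_prob_space M ?P ..
  have setsQ[measurable_cong]: "sets Q = sets ?R" by (simp add: Q_def)
  show pN: "prob_space N"
    unfolding N_def by (rule N.prob_space_axioms)
  show fst: "distr N M fst = M"
    unfolding N_def by (rule P.distr_pair_fst)
  have ev[measurable]: "(\<lambda>\<omega>. snd \<omega> n) \<in> measurable N Q" for n
    unfolding N_def by measurable
  have snd: "distr N Q (\<lambda>\<omega>. snd \<omega> n) = Q" for n
  proof -
    have "distr N Q (\<lambda>\<omega>. snd \<omega> n) = distr (distr N ?P snd) Q (\<lambda>g. g n)"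
      unfolding N_def by (subst distr_distr) (auto simp: comp_def)
    also have "distr N ?P snd = ?P"
      unfolding N_def by (rule M.distr_pair_snd) (rule P.sigma_finite_measure_axioms)
    finally show ?thesis using P.PiM_component[of n] by simp
  qed
  then show "distr N Q (\<lambda>\<omega>. snd \<omega> n) = Q" .
  let ?X = "case_option (\<lambda>\<omega> k. (\<epsilon> k \<circ> fst) \<omega>) (\<lambda>n \<omega> k. snd \<omega> n k)"
  have X_None: "?X None = (\<lambda>\<omega> k. \<epsilon> k \<omega>) \<circ> fst" and X_Some: "?X (Some n) = (\<lambda>\<omega>. snd \<omega> n)" for n
    by (auto simp: comp_def)
  have rv: "?X j \<in> measurable N ?R" for j
  proof (cases j)
    case None
    have "fst \<in> measurable N M" unfolding N_def by measurable
    then have "(\<lambda>\<omega> k. \<epsilon> k \<omega>) \<circ> fst \<in> measurable N ?R" by (rule measurable_comp[OF _ meas])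
    then show ?thesis by (simp only: None X_None)
  next
    case (Some n)
    have "measurable N Q = measurable N ?R"
      by (intro measurable_cong_sets refl setsQ)
    then show ?thesis using ev[of n] by (simp only: Some X_Some)
  qed
  have "distr N ?R (?X j) = Q" for j
  proof (cases j)
    case None
    have "distr N ?R ((\<lambda>\<omega> k. \<epsilon> k \<omega>) \<circ> fst) = distr (distr N M fst) ?R (\<lambda>\<omega> k. \<epsilon> k \<omega>)"
      unfolding N_def by (intro distr_distr[symmetric] meas) auto
    then show ?thesis by (simp only: None X_None fst Q_def)
  next
    case (Some n)
    have "distr N ?R (\<lambda>\<omega>. snd \<omega> n) = distr N Q (\<lambda>\<omega>. snd \<omega> n)"
      by (intro distr_cong refl setsQ[symmetric])
    then show ?thesis by (simp only: Some X_Some snd)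
  qed
  note law = this
  have "prob_space.indep_vars N (\<lambda>_. ?R) ?X UNIV"
    unfolding prob_space.indep_vars_def2[OF pN] prob_space.indep_sets_def[OF pN]
  proof (intro conjI ballI allI impI)
    show "?X j \<in> measurable N ?R" for j by (rule rv)
    show "{?X j -` A \<inter> space N |A. A \<in> sets ?R} \<subseteq> sets N" for j
      using measurable_sets[OF rv] by blast
    fix J :: "int option set" and A
    assume J: "finite J" "J \<noteq> {}" and A: "A \<in> Pi J (\<lambda>j. {?X j -` A \<inter> space N |A. A \<in> sets ?R})"
    from A have "\<forall>j\<in>J. \<exists>B. A j = ?X j -` B \<inter> space N \<and> B \<in> sets ?R"
      by (auto simp: Pi_iff)
    then obtain B where B: "\<And>j. j \<in> J \<Longrightarrow> A j = ?X j -` B j \<inter> space N" "\<And>j. j \<in> J \<Longrightarrow> B j \<in> sets ?R"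
      by metis
    have A_law: "emeasure N (A j) = emeasure Q (B j)" if "j \<in> J" for j
      using emeasure_distr[OF rv B(2)[OF that], of j] B(1)[OF that] by (simp only: law)
    define I where "I = {n. Some n \<in> J}"
    have "finite I"
      unfolding I_def using finite_vimageI[OF J(1), of Some] by (simp add: vimage_def)
    \<comment> \<open>If the original sequence is not among the constrained ones, the first factor of the
      rectangle is the whole space.\<close>
    define B0 where "B0 = (if None \<in> J then B None else space ?R)"
    have B0: "B0 \<in> sets ?R" using B(2) by (auto simp: B0_def)
    define U where "U = (\<lambda>\<omega> k. \<epsilon> k \<omega>) -` B0 \<inter> space M"
    define V where "V = {g \<in> space ?P. \<forall>n\<in>I. g n \<in> B (Some n)}"
    have U: "U \<in> sets M" unfolding U_def by (rule measurable_sets[OF meas B0])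
    have BI: "B (Some n) \<in> sets Q" if "n \<in> I" for n
      using B(2) that by (simp add: I_def setsQ)
    have [measurable]: "n \<in> I \<Longrightarrow> B (Some n) \<in> sets Q" for n by (rule BI)
    have V: "V \<in> sets ?P"
      unfolding V_def using \<open>finite I\<close> by measurable
    have "(\<Inter>j\<in>J. A j) = U \<times> V"
    proof (intro set_eqI iffI)
      fix \<omega> assume L: "\<omega> \<in> (\<Inter>j\<in>J. A j)"
      then have sp: "\<omega> \<in> space N" using J(2) B(1) by blast
      have "?X j \<omega> \<in> B j" if "j \<in> J" for j
        using L B(1)[OF that] that by auto
      from this[of None] this[of "Some _"] show "\<omega> \<in> U \<times> V"
        using sp measurable_space[OF meas]
        by (cases \<omega>) (auto simp: U_def V_def B0_def I_def N_def space_pair_measure comp_def)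
    next
      fix \<omega> assume R: "\<omega> \<in> U \<times> V"
      then have sp: "\<omega> \<in> space N"
        by (auto simp: U_def V_def N_def space_pair_measure)
      have "\<omega> \<in> A j" if "j \<in> J" for j
        using R sp B(1)[OF that] that
        by (cases j) (auto simp: U_def V_def B0_def I_def comp_def)
      then show "\<omega> \<in> (\<Inter>j\<in>J. A j)" by blast
    qed
    then have "emeasure N (\<Inter>j\<in>J. A j) = emeasure M U * emeasure ?P V"
      unfolding N_def using U V by (simp add: P.emeasure_pair_measure_Times)
    also have "emeasure M U = emeasure Q B0"
      unfolding U_def Q_def by (rule emeasure_distr[OF meas B0, symmetric])
    also have "\<dots> = (\<Prod>j\<in>J \<inter> {None}. emeasure Q (B j))"
      using Q.emeasure_space_1 sets_eq_imp_space_eq[OF setsQ] by (auto simp: B0_def)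
    also have "emeasure ?P V = (\<Prod>n\<in>I. emeasure Q (B (Some n)))"
      unfolding V_def using BI \<open>finite I\<close> by (intro P.emeasure_PiM_Collect) auto
    also have "\<dots> = (\<Prod>j\<in>Some ` I. emeasure Q (B j))"
      by (subst prod.reindex) (auto simp: comp_def)
    also have "(\<Prod>j\<in>J \<inter> {None}. emeasure Q (B j)) * \<dots> = (\<Prod>j\<in>J \<inter> {None} \<union> Some ` I. emeasure Q (B j))"
      using J(1) \<open>finite I\<close> by (intro prod.union_disjoint[symmetric]) auto
    also have "J \<inter> {None} \<union> Some ` I = J"
      unfolding I_def by (auto simp: image_iff) (metis option.exhaust)
    also have "(\<Prod>j\<in>J. emeasure Q (B j)) = (\<Prod>j\<in>J. emeasure N (A j))"
      by (simp add: A_law)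
    finally show "measure N (\<Inter>j\<in>J. A j) = (\<Prod>j\<in>J. measure N (A j))"
      by (simp add: finite_measure.emeasure_eq_measure[OF prob_space.finite_measure[OF pN]]
        prod_ennreal prod_nonneg)
  qed
  moreover have "distr N ?R (\<lambda>\<omega> k. snd \<omega> n k) = distr N ?R (\<lambda>\<omega> k. (\<epsilon> k \<circ> fst) \<omega>)" for n
    using law[of "Some n"] law[of None] by simp
  ultimately show "independent_copies N S (\<lambda>k. \<epsilon> k \<circ> fst) (\<lambda>n k \<omega>. snd \<omega> n k)"
    unfolding independent_copies_def by blast
qed

section \<open>Linear processes\<close>

lemma linear_process_Lp_m_approximable:
  fixes M :: "'a measure"
    and X \<epsilon> :: "int \<Rightarrow> 'a \<Rightarrow> 'h::{banach, second_countable_topology}"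
    and \<Psi> :: "nat \<Rightarrow> 'h \<Rightarrow>\<^sub>L 'h"
  assumes M: "prob_space M" and p: "1 \<le> p"
    and X: "\<And>n. X n \<in> borel_measurable M"
    and iid: "iid M borel \<epsilon>"
    and sums: "\<And>n. AE \<omega> in M. (\<lambda>j. \<Psi> j (\<epsilon> (n - int j) \<omega>)) sums X n \<omega>"
    and \<epsilon>0: "\<epsilon> 0 \<in> Lp M p"
    and fin: "(\<Sum>m. \<Sum>j. ennreal (norm (\<Psi> (Suc m + j)))) < \<infinity>"
  shows "Lp_m_approximable TYPE('h) p M X"
proof -
  interpret M: prob_space M by (rule M)
  have \<epsilon>[measurable]: "\<epsilon> k \<in> borel_measurable M" for k
    using iid by (auto simp: iid_def M.indep_vars_def2)
  have law: "distr M borel (\<epsilon> k) = distr M borel (\<epsilon> 0)" for k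
    using iid by (auto simp: iid_def)
  define C where "C = nu M p (\<epsilon> 0)"
  have C: "0 \<le> C" by (simp add: C_def nu_def)
  have law_Lp: "Y \<in> Lp N p" "nu N p Y \<le> C"
    if "Y \<in> borel_measurable N" "distr N borel Y = distr M borel (\<epsilon> 0)"
    for Y and N :: "'n measure"
    using Lp_nu_cong_law[OF that(1) \<epsilon> that(2), of p] \<epsilon>0 by (auto simp: C_def)

  have row: "(\<Sum>j. ennreal (norm (\<Psi> (Suc m + j)))) < \<infinity>" for m
    by (rule ennreal_suminf_lessD[OF fin])
  then have sum_row: "summable (\<lambda>j. norm (\<Psi> (Suc m + j)))" for m
    by (intro summable_suminf_not_top) (auto simp: less_top)
  then have sum\<Psi>: "summable (\<lambda>j. norm (\<Psi> j))"
    using summable_iff_shift[of "\<lambda>j. norm (\<Psi> j)" 1] sum_row[of 0] by simp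
  have sum_tails: "summable (\<lambda>m. \<Sum>j. norm (\<Psi> (Suc m + j)))"
    using fin sum_row
    by (intro summable_suminf_not_top suminf_nonneg) (auto simp: suminf_ennreal2 less_top)

  \<comment> \<open>Where the series diverges, \<open>f\<close> has a default value; this happens only on null sets of the
    laws concerned.\<close>
  define f :: "(nat \<Rightarrow> 'h) \<Rightarrow> 'h" where "f s = (\<Sum>j. \<Psi> j (s j))" for s
  have [measurable]: "(\<lambda>x. \<Psi> j x) \<in> borel_measurable borel" for j
    by (intro borel_measurable_continuous_onI continuous_intros)
  have f[measurable]: "f \<in> borel_measurable (Pi\<^sub>M UNIV (\<lambda>_. borel))"
    unfolding f_def by measurable
  have Xf: "AE \<omega> in M. X n \<omega> = f (\<lambda>i. \<epsilon> (n - int i) \<omega>)" for n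
    using sums[of n] by eventually_elim (simp add: f_def sums_unique)
  have XLp: "X n \<in> Lp M p" for n
    by (rule nu_operator_series_le(1)[OF p C law_Lp sum\<Psi> X sums]) (rule \<epsilon> law)+

  define Q where "Q = distr M (Pi\<^sub>M UNIV (\<lambda>_. borel)) (\<lambda>\<omega> k. \<epsilon> k \<omega>)"
  define N where "N = M \<Otimes>\<^sub>M Pi\<^sub>M UNIV (\<lambda>_::int. Q)"
  define e :: "int \<Rightarrow> 'a \<times> (int \<Rightarrow> int \<Rightarrow> 'h) \<Rightarrow> 'h" where "e k = \<epsilon> k \<circ> fst" for k
  define e' where "e' n k \<omega> = snd \<omega> n k" for n k :: int and \<omega> :: "'a \<times> (int \<Rightarrow> int \<Rightarrow> 'h)"
  note ext = independent_copies_product[of M \<epsilon>, OF M \<epsilon>, folded Q_def, folded N_def]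
  have setsQ[measurable_cong]: "sets Q = sets (Pi\<^sub>M UNIV (\<lambda>_. borel))"
    by (simp add: Q_def)
  have fst[measurable]: "fst \<in> measurable N M"
    unfolding N_def by measurable
  have snd[measurable]: "(\<lambda>\<omega>. snd \<omega> n) \<in> measurable N Q" for n
    unfolding N_def by measurable
  have coord[measurable]: "(\<lambda>s. s k) \<in> borel_measurable Q" for k
    by measurable
  have e[measurable]: "e k \<in> borel_measurable N" for k
    unfolding e_def by measurable
  have e'[measurable]: "e' n k \<in> borel_measurable N" for n k
    unfolding e'_def by measurable
  have e_law: "distr N borel (e k) = distr M borel (\<epsilon> 0)" for k
    unfolding e_def distr_distr[OF \<epsilon> fst, symmetric] ext(2) by (rule law)
  have e'_law: "distr N borel (e' n k) = distr M borel (\<epsilon> 0)" for n k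
  proof -
    have meas: "(\<lambda>\<omega> k. \<epsilon> k \<omega>) \<in> measurable M (Pi\<^sub>M UNIV (\<lambda>_. borel))"
      by (rule measurable_PiM_single') (auto intro: \<epsilon>)
    have "distr N borel (e' n k) = distr (distr N Q (\<lambda>\<omega>. snd \<omega> n)) borel (\<lambda>s. s k)"
      by (subst distr_distr[OF coord snd]) (simp add: e'_def[abs_def] comp_def)
    also have "\<dots> = distr M borel (\<epsilon> k)"
      unfolding ext(3) unfolding Q_def by (subst distr_distr[OF _ meas]) (simp_all add: comp_def)
    finally show ?thesis unfolding law[of k] .
  qed

  define D where "D m \<omega> = X (int m) (fst \<omega>) - coupled f e e' m (int m) \<omega>" for m \<omega>
  have D: "D m \<in> Lp N p" "nu N p (D m) \<le> (\<Sum>j. norm (\<Psi> (m + j))) * (2 * C)" for m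
  proof -
    define s where "s j = (if j < m then e (int m - int j) else e' (int m) (int m - int j))" for j
    \<comment> \<open>Indexed from \<open>0\<close>: \<open>Y j\<close> is the difference of the innovations with lag \<open>j + m\<close>.\<close>
    define Y where "Y j \<omega> = e (int m - int (j + m)) \<omega> - e' (int m) (int m - int (j + m)) \<omega>" for j \<omega>
    have [measurable]: "s j \<in> borel_measurable N" for j
      by (simp add: s_def)
    have coupled: "coupled f e e' m (int m) \<omega> = f (\<lambda>j. s j \<omega>)" for \<omega>
      unfolding coupled_def s_def by (intro arg_cong[where f = f]) auto
    have "(\<lambda>\<omega>. \<lambda>j. s j \<omega>) \<in> measurable N (Pi\<^sub>M UNIV (\<lambda>_. borel))"
      by (rule measurable_PiM_single') auto
    then have Dm: "D m \<in> borel_measurable N"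
      unfolding D_def coupled using X by measurable
    have Y: "Y j \<in> Lp N p" "nu N p (Y j) \<le> 2 * C" for j
      unfolding Y_def by (intro Lp_diff[OF p C] law_Lp e e' e_law e'_law)+
    have "AE \<omega> in N. (\<lambda>j. \<Psi> j (e (int m - int j) \<omega>)) sums X (int m) (fst \<omega>)"
      using AE_distrD[OF fst, unfolded ext(2), OF sums[of "int m"]] by (simp add: e_def)
    \<comment> \<open>The marginal laws of the mixed sequence \<open>s\<close> are all that of \<open>\<epsilon> 0\<close>.\<close>
    moreover have "AE \<omega> in N. summable (\<lambda>j. norm (\<Psi> j (s j \<omega>)))"
      by (rule AE_summable_norm_operator_series[OF p C law_Lp sum\<Psi>])
        (auto simp: s_def e_law e'_law)
    ultimately have "AE \<omega> in N. (\<lambda>j. \<Psi> (j + m) (Y j \<omega>)) sums D m \<omega>"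
    proof eventually_elim
      case (elim \<omega>)
      have "(\<lambda>j. \<Psi> j (s j \<omega>)) sums f (\<lambda>j. s j \<omega>)"
        unfolding f_def by (rule summable_sums[OF summable_norm_cancel[OF elim(2)]])
      then have "(\<lambda>j. \<Psi> j (e (int m - int j) \<omega>) - \<Psi> j (s j \<omega>)) sums D m \<omega>"
        unfolding D_def coupled by (rule sums_diff[OF elim(1)])
      then have "(\<lambda>j. \<Psi> (j + m) (e (int m - int (j + m)) \<omega>) - \<Psi> (j + m) (s (j + m) \<omega>)) sums D m \<omega>"
        by (subst sums_zero_iff_shift) (auto simp: s_def)
      then show ?case
        by (simp add: Y_def s_def blinfun.diff_right)
    qed
    note series = nu_operator_series_le[OF p _ Y _ Dm this]
    have "summable (\<lambda>j. norm (\<Psi> (j + m)))"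
      using sum\<Psi> by (rule summable_ignore_initial_segment)
    with series C show "D m \<in> Lp N p" "nu N p (D m) \<le> (\<Sum>j. norm (\<Psi> (m + j))) * (2 * C)"
      by (auto simp: add.commute)
  qed
  have "summable (\<lambda>m. nu N p (D (Suc m)))"
    by (rule summable_comparison_test'[OF summable_mult2[OF sum_tails, of "2 * C"], of 0])
      (use D(2)[of "Suc _"] in \<open>simp add: nu_def\<close>)
  moreover have "independent_copies N borel (\<lambda>k. \<epsilon> k \<circ> fst) e'"
    using ext(4) by (simp add: e'_def[abs_def])
  ultimately show ?thesis
    using XLp iid f Xf ext(1,2) fst D(1)
    unfolding Lp_m_approximable_def D_def[abs_def] e_def[abs_def]
    by blast
qed

theorem proposition2p1:
  fixes M :: "'a measure"
    and X \<epsilon> :: "int \<Rightarrow> 'a \<Rightarrow> L2"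
    and \<Psi> :: "nat \<Rightarrow> L2 \<Rightarrow>\<^sub>L L2"
    and p :: real
  assumes "prob_space M"
    and "p \<ge> 2"
    and "\<And>n. X n \<in> Lp M 2"
    and "\<And>n. \<epsilon> n \<in> Lp M 2"
    and "iid M borel \<epsilon>"
    and "\<And>n. (\<integral>\<omega>. \<epsilon> n \<omega> \<partial>M) = 0"
    and "\<And>n. AE \<omega> in M. (\<lambda>j. \<Psi> j (\<epsilon> (n - int j) \<omega>)) sums X n \<omega>"
    and "\<epsilon> 0 \<in> Lp M p"
    and "(\<Sum>m. \<Sum>j. ennreal (norm (\<Psi> (Suc m + j)))) < \<infinity>"
  shows "Lp_m_approximable TYPE(L2) p M X"
proof (rule linear_process_Lp_m_approximable[OF assms(1) _ _ assms(5,7,8,9)])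
  show "1 \<le> p" using assms(2) by simp
  show "X n \<in> borel_measurable M" for n using assms(3) by (simp add: Lp_def)
qed

end
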